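(* Let $V=\mathbb{C}[x^2]\oplus x\mathbb{C}[x^2]$, a $\mathbb{Z}_2$-graded vector space with $V_{\bar 0}=\mathbb{C}[x^2]$ and $V_{\bar 1}=x\mathbb{C}[x^2]$. Let $\lambda\in\mathbb{C}^*$ and $\alpha\in\mathbb{C}$. For $m\in\mathbb{Z}$ and $f(x^2)\in\mathbb{C}[x^2]$ define $$L_m f(x^2)=\lambda^m(x^2+m\alpha)f(x^2+m),$$ $$L_m\, xf(x^2)=\lambda^m x\left(x^2+m\alpha+\tfrac m2\right)f(x^2+m),$$ $$G_m f(x^2)=\lambda^m x f(x^2+m),$$ $$G_m\, xf(x^2)=\lambda^m(x^2+2m\alpha)f(x^2+m).$$ Then $V$ is a module over the Ramond algebra $\mathcal{R}$ under this action.
   Context: All spaces are over $\mathbb{C}$; $\mathbb{C}^*$ is the set of nonzero complex numbers. The Ramond algebra $\mathcal{R}$ (super-Virasoro algebra of Ramond type, without center) is the Lie superalgebra whose even part has basis $\{L_n\mid n\in\mathbb{Z}\}$ and whose odd part has basis $\{G_r\mid r\in\mathbb{Z}\}$, with brackets $[L_m,L_n]=(m-n)L_{m+n}$, $[L_m,G_r]=(\frac m2-r)G_{m+r}$, $[G_r,G_s]=2L_{r+s}$ for $m,n,r,s\in\mathbb{Z}$. A module over a Lie superalgebra $A$ always means a supermodule $M=M_{\bar 0}\oplus M_{\bar 1}$ with $A_{\bar i}\cdot M_{\bar j}\subseteq M_{\bar i+\bar j}$. For $f(t)\in\mathbb{C}[t]$, $f(x^2)$ and $f(x^2+m)$ denote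 the results of substituting $t=x^2$ and $t=x^2+m$. *)

theory Defs
  imports
    Complex_Main
    "HOL-Library.Z2"
    "HOL-Library.Poly_Mapping"
    "HOL-Computational_Algebra.Polynomial"
begin

section \<open>Lie superalgebras and their supermodules\<close>

text \<open>
  The grading group is the additive group of \<^typ>\<open>bit\<close>, the field with two elements.
  The underlying space is the whole type, and \<open>gr 0\<close>, \<open>gr 1\<close> are its even and odd
  homogeneous parts.
\<close>

locale super_vector_space = vector_space scale
  for scale :: "complex \<Rightarrow> 'v::ab_group_add \<Rightarrow> 'v" +
  fixes gr :: "bit \<Rightarrow> 'v set"
  assumes subspace_gr: "subspace (gr i)"
    and gr_Int: "gr 0 \<inter> gr 1 = {0}"
    and gr_sum: "\<exists>a\<in>gr 0. \<exists>b\<in>gr 1. v = a + b"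

definition koszul :: "bit \<Rightarrow> bit \<Rightarrow> complex" where
  "koszul i j = (if i = 1 \<and> j = 1 then -1 else 1)"

locale lie_superalgebra = super_vector_space scale gr
  for scale :: "complex \<Rightarrow> 'a::ab_group_add \<Rightarrow> 'a" and gr :: "bit \<Rightarrow> 'a set" +
  fixes brk :: "'a \<Rightarrow> 'a \<Rightarrow> 'a"
  assumes linear_brk_left: "Vector_Spaces.linear scale scale (\<lambda>a. brk a b)"
    and linear_brk_right: "Vector_Spaces.linear scale scale (brk a)"
    and brk_gr: "a \<in> gr i \<Longrightarrow> b \<in> gr j \<Longrightarrow> brk a b \<in> gr (i + j)"
    and brk_skew: "a \<in> gr i \<Longrightarrow> b \<in> gr j \<Longrightarrow> brk a b = - scale (koszul i j) (brk b a)"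
    and brk_jacobi: "a \<in> gr i \<Longrightarrow> b \<in> gr j \<Longrightarrow> c \<in> gr k \<Longrightarrow>
      brk a (brk b c) = brk (brk a b) c + scale (koszul i j) (brk b (brk a c))"

locale lie_supermodule =
  A: lie_superalgebra scaleA grA brk + V: super_vector_space scaleV grV
  for scaleA :: "complex \<Rightarrow> 'a::ab_group_add \<Rightarrow> 'a" and grA :: "bit \<Rightarrow> 'a set"
    and brk :: "'a \<Rightarrow> 'a \<Rightarrow> 'a"
    and scaleV :: "complex \<Rightarrow> 'v::ab_group_add \<Rightarrow> 'v" and grV :: "bit \<Rightarrow> 'v set" +
  fixes act :: "'a \<Rightarrow> 'v \<Rightarrow> 'v"
  assumes linear_act_left: "Vector_Spaces.linear scaleA scaleV (\<lambda>a. act a v)"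
    and linear_act_right: "Vector_Spaces.linear scaleV scaleV (act a)"
    and act_gr: "a \<in> grA i \<Longrightarrow> v \<in> grV j \<Longrightarrow> act a v \<in> grV (i + j)"
    and act_brk: "a \<in> grA i \<Longrightarrow> b \<in> grA j \<Longrightarrow>
      act (brk a b) v = act a (act b v) - scaleV (koszul i j) (act b (act a v))"


section \<open>The Ramond algebra\<close>

datatype ramond_basis = L int | G int

type_synonym ramond = "ramond_basis \<Rightarrow>\<^sub>0 complex"

definition rscale :: "complex \<Rightarrow> ramond \<Rightarrow> ramond" where
  "rscale c a = Poly_Mapping.map ((*) c) a"

fun parity :: "ramond_basis \<Rightarrow> bit" where
  "parity (L n) = 0"
| "parity (G r) = 1"

definition ramond_gr :: "bit \<Rightarrow> ramond set" where
  "ramond_gr i = {a. \<forall>b\<in>Poly_Mapping.keys a. parity b = i}"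

text \<open>The linear extension of a map defined on the basis.\<close>

definition lin_ext ::
    "(complex \<Rightarrow> 'v::ab_group_add \<Rightarrow> 'v) \<Rightarrow> (ramond_basis \<Rightarrow> 'v) \<Rightarrow> ramond \<Rightarrow> 'v" where
  "lin_ext scale F a =
     (\<Sum>b\<in>Poly_Mapping.keys a. scale (Poly_Mapping.lookup a b) (F b))"

text \<open>The value on \<open>(G r, L m)\<close> is forced by super skew-symmetry: \<open>[G r, L m] = - [L m, G r]\<close>.\<close>

fun basis_bracket :: "ramond_basis \<Rightarrow> ramond_basis \<Rightarrow> ramond" where
  "basis_bracket (L m) (L n) = Poly_Mapping.single (L (m + n)) (of_int (m - n))"
| "basis_bracket (L m) (G r) = Poly_Mapping.single (G (m + r)) (of_int m / 2 - of_int r)"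
| "basis_bracket (G r) (L m) = Poly_Mapping.single (G (m + r)) (- (of_int m / 2 - of_int r))"
| "basis_bracket (G r) (G s) = Poly_Mapping.single (L (r + s)) 2"

definition ramond_bracket :: "ramond \<Rightarrow> ramond \<Rightarrow> ramond" where
  "ramond_bracket a b = lin_ext rscale (\<lambda>i. lin_ext rscale (basis_bracket i) b) a"


section \<open>The space \<open>\<complex>[x\<^sup>2] \<oplus> x\<complex>[x\<^sup>2]\<close> and the operators on it\<close>

text \<open>
  The space is realised inside \<open>\<complex>[x]\<close>, which it exhausts. A polynomial \<open>f(t)\<close> is a
  \<^typ>\<open>complex poly\<close>, and \<open>f(x\<^sup>2 + m)\<close> is obtained by composition.
\<close>

abbreviation X :: "complex poly" where
  "X \<equiv> [:0, 1:]"

definition sq_plus :: "complex \<Rightarrow> complex poly" where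
  "sq_plus c = X\<^sup>2 + [:c:]"

definition V_gr :: "bit \<Rightarrow> complex poly set" where
  "V_gr i = (if i = 0 then range (\<lambda>f. f \<circ>\<^sub>p X\<^sup>2) else range (\<lambda>f. X * (f \<circ>\<^sub>p X\<^sup>2)))"

text \<open>
  \<open>even_coeffs v\<close> and \<open>odd_coeffs v\<close> are the unique \<open>f\<close> and \<open>g\<close> with
  \<open>v = f(x\<^sup>2) + x g(x\<^sup>2)\<close>.
\<close>

definition even_coeffs :: "complex poly \<Rightarrow> complex poly" where
  "even_coeffs v = (\<Sum>k\<le>degree v. monom (coeff v (2 * k)) k)"

definition odd_coeffs :: "complex poly \<Rightarrow> complex poly" where
  "odd_coeffs v = (\<Sum>k\<le>degree v. monom (coeff v (2 * k + 1)) k)"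

text \<open>The map sending \<open>f(x\<^sup>2)\<close> to \<open>F f\<close> and \<open>x f(x\<^sup>2)\<close> to \<open>H f\<close>, extended additively to all of \<open>\<complex>[x]\<close>.\<close>

definition on_parts ::
    "(complex poly \<Rightarrow> complex poly) \<Rightarrow> (complex poly \<Rightarrow> complex poly) \<Rightarrow>
     complex poly \<Rightarrow> complex poly" where
  "on_parts F H v = F (even_coeffs v) + H (odd_coeffs v)"

definition L_op :: "complex \<Rightarrow> complex \<Rightarrow> int \<Rightarrow> complex poly \<Rightarrow> complex poly" where
  "L_op lam al m = on_parts
     (\<lambda>f. smult (lam powi m) (sq_plus (of_int m * al) * (f \<circ>\<^sub>p sq_plus (of_int m))))
     (\<lambda>f. smult (lam powi m)
        (X * sq_plus (of_int m * al + of_int m / 2) * (f \<circ>\<^sub>p sq_plus (of_int m))))"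

definition G_op :: "complex \<Rightarrow> complex \<Rightarrow> int \<Rightarrow> complex poly \<Rightarrow> complex poly" where
  "G_op lam al m = on_parts
     (\<lambda>f. smult (lam powi m) (X * (f \<circ>\<^sub>p sq_plus (of_int m))))
     (\<lambda>f. smult (lam powi m) (sq_plus (2 * of_int m * al) * (f \<circ>\<^sub>p sq_plus (of_int m))))"

fun basis_act :: "complex \<Rightarrow> complex \<Rightarrow> ramond_basis \<Rightarrow> complex poly \<Rightarrow> complex poly" where
  "basis_act lam al (L m) = L_op lam al m"
| "basis_act lam al (G m) = G_op lam al m"

definition ramond_act :: "complex \<Rightarrow> complex \<Rightarrow> ramond \<Rightarrow> complex poly \<Rightarrow> complex poly" where
  "ramond_act lam al a v = lin_ext smult (\<lambda>b. basis_act lam al b v) a"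


section \<open>The defining formulas\<close>

lemma coeff_pcompose_sq:
  "coeff (f \<circ>\<^sub>p X\<^sup>2) n = (if even n then coeff f (n div 2) else 0)"
proof (induction f arbitrary: n)
  case (pCons a f)
  have sq: "X\<^sup>2 * p = pCons 0 (pCons 0 p)" for p :: "complex poly"
    by (simp add: power2_eq_square)
  show ?case
  proof (cases n)
    case 0
    then show ?thesis by (simp add: pcompose_pCons sq)
  next
    case (Suc k)
    then show ?thesis
      using pCons.IH by (cases k) (auto simp: pcompose_pCons sq)
  qed
qed simp

lemma coeff_even_coeffs: "coeff (even_coeffs v) k = coeff v (2 * k)"
  by (auto simp: even_coeffs_def coeff_sum coeff_eq_0 intro!: coeff_eq_0)

lemma coeff_odd_coeffs: "coeff (odd_coeffs v) k = coeff v (2 * k + 1)"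
  by (auto simp: odd_coeffs_def coeff_sum coeff_eq_0 intro!: coeff_eq_0)

lemma even_odd_coeffs [simp]:
  "even_coeffs (f \<circ>\<^sub>p X\<^sup>2) = f" "odd_coeffs (f \<circ>\<^sub>p X\<^sup>2) = 0"
  "even_coeffs (X * (f \<circ>\<^sub>p X\<^sup>2)) = 0" "odd_coeffs (X * (f \<circ>\<^sub>p X\<^sup>2)) = f"
  by (auto simp: poly_eq_iff coeff_even_coeffs coeff_odd_coeffs coeff_pcompose_sq coeff_pCons
           split: nat.split) (metis even_Suc even_mult_iff even_numeral)

lemma even_odd_decomposition:
  "v = (even_coeffs v \<circ>\<^sub>p X\<^sup>2) + X * (odd_coeffs v \<circ>\<^sub>p X\<^sup>2)"
  by (auto simp: poly_eq_iff coeff_even_coeffs coeff_odd_coeffs coeff_pcompose_sq coeff_pCons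
           split: nat.split)

lemma rscale_single [simp]:
  "rscale c (Poly_Mapping.single b d) = Poly_Mapping.single b (c * d)"
  by (simp add: rscale_def)

lemma lookup_rscale [simp]:
  "Poly_Mapping.lookup (rscale c a) b = c * Poly_Mapping.lookup a b"
  by (simp add: rscale_def map.rep_eq when_def)

lemma ramond_bracket_basis:
  "ramond_bracket (Poly_Mapping.single i 1) (Poly_Mapping.single j 1) = basis_bracket i j"
proof -
  have "rscale 1 a = a" for a
    by (simp add: poly_mapping_eq_iff fun_eq_iff)
  then show ?thesis by (simp add: ramond_bracket_def lin_ext_def)
qed

lemma ramond_act_formulas:
  "ramond_act lam al (Poly_Mapping.single (L m) 1) (f \<circ>\<^sub>p X\<^sup>2) =
     smult (lam powi m) (sq_plus (of_int m * al) * (f \<circ>\<^sub>p sq_plus (of_int m)))"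
  "ramond_act lam al (Poly_Mapping.single (L m) 1) (X * (f \<circ>\<^sub>p X\<^sup>2)) =
     smult (lam powi m)
       (X * sq_plus (of_int m * al + of_int m / 2) * (f \<circ>\<^sub>p sq_plus (of_int m)))"
  "ramond_act lam al (Poly_Mapping.single (G m) 1) (f \<circ>\<^sub>p X\<^sup>2) =
     smult (lam powi m) (X * (f \<circ>\<^sub>p sq_plus (of_int m)))"
  "ramond_act lam al (Poly_Mapping.single (G m) 1) (X * (f \<circ>\<^sub>p X\<^sup>2)) =
     smult (lam powi m) (sq_plus (2 * of_int m * al) * (f \<circ>\<^sub>p sq_plus (of_int m)))"
proof -
  have act: "ramond_act lam al (Poly_Mapping.single b 1) v = basis_act lam al b v" for b v
    by (simp add: ramond_act_def lin_ext_def)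
  show
    "ramond_act lam al (Poly_Mapping.single (L m) 1) (f \<circ>\<^sub>p X\<^sup>2) =
       smult (lam powi m) (sq_plus (of_int m * al) * (f \<circ>\<^sub>p sq_plus (of_int m)))"
    "ramond_act lam al (Poly_Mapping.single (L m) 1) (X * (f \<circ>\<^sub>p X\<^sup>2)) =
       smult (lam powi m)
         (X * sq_plus (of_int m * al + of_int m / 2) * (f \<circ>\<^sub>p sq_plus (of_int m)))"
    "ramond_act lam al (Poly_Mapping.single (G m) 1) (f \<circ>\<^sub>p X\<^sup>2) =
       smult (lam powi m) (X * (f \<circ>\<^sub>p sq_plus (of_int m)))"
    "ramond_act lam al (Poly_Mapping.single (G m) 1) (X * (f \<circ>\<^sub>p X\<^sup>2)) =
       smult (lam powi m) (sq_plus (2 * of_int m * al) * (f \<circ>\<^sub>p sq_plus (of_int m)))"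
    by (simp_all only: act basis_act.simps L_op_def G_op_def on_parts_def even_odd_coeffs
          pcompose_0 mult_zero_right smult_0_right add_0_left add_0_right)
qed

end

theory Submission
  imports Defs
begin

text \<open>
  Under \<open>x\<^sup>2 = t\<close> both graded parts of the space become \<open>\<complex>[t]\<close>, and each \<open>L m\<close> or \<open>G m\<close> becomes
  multiplication by \<open>lam\<^sup>m\<close> times a polynomial of degree at most one, composed with the shift
  \<open>t \<mapsto> t + m\<close>. By bilinearity the module axiom is only needed on basis elements, where it
  compares the polynomial factors of two operators having the same shift \<open>t \<mapsto> t + m + n\<close>.
\<close>

section \<open>Linear extension from the basis\<close>

text \<open>Keys outside the support contribute only zero terms. The free choice of \<open>S\<close>
  lets elements with different supports be summed over one index set, since cancellation can shrink
  the keys of a sum or a multiple.\<close>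

lemma lin_ext_superset:
  assumes "vector_space scale" "finite S" "Poly_Mapping.keys a \<subseteq> S"
  shows "lin_ext scale F a = (\<Sum>b\<in>S. scale (Poly_Mapping.lookup a b) (F b))"
proof -
  interpret vector_space scale by fact
  show ?thesis
    unfolding lin_ext_def
    by (rule sum.mono_neutral_left) (use assms in \<open>auto simp: in_keys_iff\<close>)
qed

lemma lin_ext_add:
  assumes "vector_space scale"
  shows "lin_ext scale F (a + b) = lin_ext scale F a + lin_ext scale F b"
proof -
  interpret vector_space scale by fact
  let ?S = "Poly_Mapping.keys a \<union> Poly_Mapping.keys b"
  have "Poly_Mapping.keys (a + b) \<subseteq> ?S" by (rule Poly_Mapping.keys_add)
  then show ?thesis
    by (simp add: lin_ext_superset[OF assms, of ?S] lookup_add scale_left_distrib sum.distrib)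
qed

lemma lin_ext_rscale:
  assumes "vector_space scale"
  shows "lin_ext scale F (rscale c a) = scale c (lin_ext scale F a)"
proof -
  interpret vector_space scale by fact
  have "Poly_Mapping.keys (rscale c a) \<subseteq> Poly_Mapping.keys a"
    by (auto simp: in_keys_iff)
  then show ?thesis
    by (simp add: lin_ext_superset[OF assms, of "Poly_Mapping.keys a"] scale_sum_right)
qed

lemma lin_ext_add_fun:
  assumes "vector_space scale"
  shows "lin_ext scale (\<lambda>b. F b + H b) a = lin_ext scale F a + lin_ext scale H a"
proof -
  interpret vector_space scale by fact
  show ?thesis by (simp add: lin_ext_def scale_right_distrib sum.distrib)
qed

lemma lin_ext_scale_fun:
  assumes "vector_space scale"
  shows "lin_ext scale (\<lambda>b. scale c (F b)) a = scale c (lin_ext scale F a)"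
proof -
  interpret vector_space scale by fact
  show ?thesis by (simp add: lin_ext_def scale_sum_right mult.commute)
qed

lemma lin_ext_single:
  assumes "vector_space scale"
  shows "lin_ext scale F (Poly_Mapping.single b c) = scale c (F b)"
proof -
  interpret vector_space scale by fact
  show ?thesis by (simp add: lin_ext_def)
qed

lemma vector_space_linearI:
  fixes s1 :: "complex \<Rightarrow> 'a::ab_group_add \<Rightarrow> 'a" and s2 :: "complex \<Rightarrow> 'b::ab_group_add \<Rightarrow> 'b"
  assumes "vector_space s1" "vector_space s2"
    "\<And>a b. f (a + b) = f a + f b" "\<And>c a. f (s1 c a) = s2 c (f a)"
  shows "Vector_Spaces.linear s1 s2 f"
proof -
  interpret v1: vector_space s1 by fact
  interpret v2: vector_space s2 by fact
  show ?thesis by unfold_locales (simp_all add: assms)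
qed


section \<open>The Ramond algebra\<close>

lemma vector_space_rscale: "vector_space rscale"
  by unfold_locales
    (simp_all add: poly_mapping_eq_iff fun_eq_iff lookup_add algebra_simps)

interpretation rscale: vector_space rscale
  by (rule vector_space_rscale)

lemma sum_singles:
  "(\<Sum>b\<in>Poly_Mapping.keys a. Poly_Mapping.single b (Poly_Mapping.lookup a b)) = a"
  by (rule poly_mapping_eqI)
    (simp add: lookup_sum lookup_single when_def in_keys_iff)

text \<open>An element of \<open>ramond_gr i\<close> is the finite sum of its singles, all of parity
  \<open>i\<close>. The rule reduces statements that are linear in a homogeneous argument to basis
  elements; the scalar is kept outside as \<open>rscale c\<close> so that linearity can extract
  it.\<close>

lemma ramond_gr_induct [consumes 1, case_names zero single add]:
  assumes "a \<in> ramond_gr i" and "P 0"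
    and "\<And>b c. parity b = i \<Longrightarrow> P (rscale c (Poly_Mapping.single b 1))"
    and "\<And>a b. P a \<Longrightarrow> P b \<Longrightarrow> P (a + b)"
  shows "P a"
proof -
  have "P (\<Sum>b\<in>S. Poly_Mapping.single b (Poly_Mapping.lookup a b))"
    if "finite S" "S \<subseteq> Poly_Mapping.keys a" for S
    using that
  proof (induction S)
    case (insert b S)
    then have "parity b = i" using assms(1) by (auto simp: ramond_gr_def)
    from assms(3)[OF this, of "Poly_Mapping.lookup a b"] insert show ?case
      by (auto intro: assms(4))
  qed (simp add: assms(2))
  from this[of "Poly_Mapping.keys a"] show ?thesis
    by (simp add: sum_singles)
qed

lemma subspace_ramond_gr: "rscale.subspace (ramond_gr i)"
  unfolding rscale.subspace_def ramond_gr_def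
  by (auto simp: in_keys_iff lookup_add)

lemma single_in_ramond_gr: "Poly_Mapping.single b c \<in> ramond_gr (parity b)"
  by (auto simp: ramond_gr_def)

lemma super_vector_space_ramond: "super_vector_space rscale ramond_gr"
proof unfold_locales
  show "rscale.subspace (ramond_gr i)" for i by (rule subspace_ramond_gr)
  show "ramond_gr 0 \<inter> ramond_gr 1 = {0}"
    by (auto simp: ramond_gr_def)
  show "\<exists>a\<in>ramond_gr 0. \<exists>b\<in>ramond_gr 1. v = a + b" for v
  proof -
    \<comment> \<open>The homogeneous components: the terms of \<open>v\<close> sorted by the parity
      of their keys.\<close>
    let ?p = "\<lambda>i. \<Sum>b\<in>{b \<in> Poly_Mapping.keys v. parity b = i}.
      Poly_Mapping.single b (Poly_Mapping.lookup v b)"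
    have "?p i \<in> ramond_gr i" for i
      by (rule rscale.subspace_sum[OF subspace_ramond_gr]) (use single_in_ramond_gr in auto)
    moreover have "v = ?p 0 + ?p 1"
    proof -
      have "v = (\<Sum>b\<in>Poly_Mapping.keys v. Poly_Mapping.single b (Poly_Mapping.lookup v b))"
        by (simp add: sum_singles)
      also have "Poly_Mapping.keys v =
          {b \<in> Poly_Mapping.keys v. parity b = 0} \<union> {b \<in> Poly_Mapping.keys v. parity b = 1}"
        by (auto simp: bit_not_one_iff)
      also have "(\<Sum>b\<in>\<dots>. Poly_Mapping.single b (Poly_Mapping.lookup v b)) = ?p 0 + ?p 1"
        by (rule sum.union_disjoint) auto
      finally show ?thesis .
    qed
    ultimately show ?thesis by blast
  qed
qed

section \<open>Bilinearity of the bracket\<close>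

lemma ramond_bracket_add_left: "ramond_bracket (a + a') b = ramond_bracket a b + ramond_bracket a' b"
  by (simp add: ramond_bracket_def lin_ext_add vector_space_rscale)

lemma ramond_bracket_scale_left: "ramond_bracket (rscale c a) b = rscale c (ramond_bracket a b)"
  by (simp add: ramond_bracket_def lin_ext_rscale vector_space_rscale)

lemma ramond_bracket_add_right: "ramond_bracket a (b + b') = ramond_bracket a b + ramond_bracket a b'"
  by (simp add: ramond_bracket_def lin_ext_add lin_ext_add_fun vector_space_rscale)

lemma ramond_bracket_scale_right: "ramond_bracket a (rscale c b) = rscale c (ramond_bracket a b)"
  by (simp add: ramond_bracket_def lin_ext_rscale lin_ext_scale_fun[OF vector_space_rscale] vector_space_rscale)

lemma ramond_bracket_zero: "ramond_bracket 0 b = 0" "ramond_bracket a 0 = 0"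
  using ramond_bracket_scale_left[of 0 0 b] ramond_bracket_scale_right[of a 0 0] by simp_all

lemma ramond_bracket_single:
  "ramond_bracket (Poly_Mapping.single i c) (Poly_Mapping.single j d) =
     rscale (c * d) (basis_bracket i j)"
  by (simp add: ramond_bracket_def lin_ext_single vector_space_rscale)

lemmas ramond_bracket_linear =
  ramond_bracket_add_left ramond_bracket_add_right
  ramond_bracket_scale_left ramond_bracket_scale_right ramond_bracket_zero

section \<open>The superalgebra axioms, on basis elements and then on homogeneous ones\<close>

lemma basis_bracket_gr: "basis_bracket i j \<in> ramond_gr (parity i + parity j)"
  by (cases i; cases j) (auto simp: ramond_gr_def split: if_splits)

text \<open>The mixed cases hold by the choice of the value on \<open>(G r, L m)\<close>. For two
  odd elements the Koszul sign cancels the minus sign, which fits the symmetric value 2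
  L_(r+s).\<close>

lemma basis_bracket_skew:
  "basis_bracket i j = - rscale (koszul (parity i) (parity j)) (basis_bracket j i)"
  by (cases i; cases j)
    (simp_all add: koszul_def single_uminus[symmetric] add.commute)

text \<open>All three double brackets are multiples of one basis vector, with index the sum of the
  three indices. Each of the eight cases is thus a polynomial identity between coefficients.\<close>

lemma basis_bracket_jacobi:
  fixes i j k :: ramond_basis
  defines "e \<equiv> \<lambda>b. Poly_Mapping.single b 1"
  shows "ramond_bracket (e i) (ramond_bracket (e j) (e k)) =
    ramond_bracket (ramond_bracket (e i) (e j)) (e k) +
    rscale (koszul (parity i) (parity j)) (ramond_bracket (e j) (ramond_bracket (e i) (e k)))"
  unfolding e_def
  \<comment> \<open>\<open>arg_cong2\<close> splits each remaining equation of singles into one for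
    the indices and one for the coefficients.\<close>
  by (cases i; cases j; cases k)
    (simp_all add: ramond_bracket_single koszul_def single_add[symmetric] add_ac,
     (rule arg_cong2[where f = Poly_Mapping.single], simp, simp add: field_simps)+)

lemma ramond_bracket_gr:
  assumes "a \<in> ramond_gr i" "b \<in> ramond_gr j"
  shows "ramond_bracket a b \<in> ramond_gr (i + j)"
  using assms(1)
proof (induction a rule: ramond_gr_induct)
  case (single s c)
  from assms(2) have "ramond_bracket (Poly_Mapping.single s 1) b \<in> ramond_gr (i + j)"
  proof (induction b rule: ramond_gr_induct)
    case (single t d)
    then show ?case
      using basis_bracket_gr[of s t] \<open>parity s = i\<close>
      by (simp add: ramond_bracket_single rscale.subspace_scale[OF subspace_ramond_gr])
  qed (simp_all add: ramond_bracket_linear rscale.subspace_0 rscale.subspace_add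
         subspace_ramond_gr)
  \<comment> \<open>Full simplification would merge
    \<open>rscale c (Poly_Mapping.single s 1)\<close> into one single, and the fact just proved
    would no longer match; \<open>simp only\<close> extracts \<open>c\<close> instead.\<close>
  then show ?case
    by (simp only: ramond_bracket_linear rscale.subspace_scale[OF subspace_ramond_gr])
qed (simp_all add: ramond_bracket_linear rscale.subspace_0 rscale.subspace_add subspace_ramond_gr)

lemma ramond_bracket_skew:
  assumes "a \<in> ramond_gr i" "b \<in> ramond_gr j"
  shows "ramond_bracket a b = - rscale (koszul i j) (ramond_bracket b a)"
  using assms(1)
proof (induction a rule: ramond_gr_induct)
  case (single s c)
  from assms(2) have "ramond_bracket (Poly_Mapping.single s 1) b =
      - rscale (koszul i j) (ramond_bracket b (Poly_Mapping.single s 1))"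
  proof (induction b rule: ramond_gr_induct)
    case (single t d)
    then show ?case
      using basis_bracket_skew[of s t] \<open>parity s = i\<close>
      by (simp add: ramond_bracket_single mult.commute)
  qed (simp_all add: ramond_bracket_linear rscale.scale_right_distrib)
  then show ?case
    by (simp only: ramond_bracket_linear) (simp add: mult.commute)
qed (simp_all add: ramond_bracket_linear rscale.scale_right_distrib)

text \<open>Both sides are linear in each argument, and the sign \<open>koszul i j\<close> is
  constant on homogeneous parts, so three nested inductions lead down to
  \<open>basis_bracket_jacobi\<close>.\<close>

lemma ramond_bracket_jacobi:
  assumes "a \<in> ramond_gr i" "b \<in> ramond_gr j" "c \<in> ramond_gr k"
  shows "ramond_bracket a (ramond_bracket b c) =
    ramond_bracket (ramond_bracket a b) c + rscale (koszul i j) (ramond_bracket b (ramond_bracket a c))"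
  using assms(1)
proof (induction a rule: ramond_gr_induct)
  case (single s x)
  let ?s = "Poly_Mapping.single s 1"
  from assms(2) have "ramond_bracket ?s (ramond_bracket b c) =
    ramond_bracket (ramond_bracket ?s b) c + rscale (koszul i j) (ramond_bracket b (ramond_bracket ?s c))"
  proof (induction b rule: ramond_gr_induct)
    case (single t y)
    let ?t = "Poly_Mapping.single t 1"
    from assms(3) have "ramond_bracket ?s (ramond_bracket ?t c) =
      ramond_bracket (ramond_bracket ?s ?t) c +
      rscale (koszul i j) (ramond_bracket ?t (ramond_bracket ?s c))"
    proof (induction c rule: ramond_gr_induct)
      case (single u z)
      show ?case
        using basis_bracket_jacobi[of s t u] \<open>parity s = i\<close> \<open>parity t = j\<close>
        by (simp only: ramond_bracket_linear) (simp add: rscale.scale_right_distrib mult.commute)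
    qed (simp_all add: ramond_bracket_linear rscale.scale_right_distrib)
    then show ?case
      by (simp only: ramond_bracket_linear) (simp add: rscale.scale_right_distrib mult.commute)
  qed (simp_all add: ramond_bracket_linear rscale.scale_right_distrib)
  then show ?case
    by (simp only: ramond_bracket_linear) (simp add: rscale.scale_right_distrib mult.commute)
qed (simp_all add: ramond_bracket_linear rscale.scale_right_distrib)

lemma lie_superalgebra_ramond: "lie_superalgebra rscale ramond_gr ramond_bracket"
proof -
  interpret super_vector_space rscale ramond_gr by (rule super_vector_space_ramond)
  show ?thesis
    by unfold_locales
      (rule vector_space_linearI ramond_bracket_gr ramond_bracket_skew ramond_bracket_jacobi
        vector_space_rscale ramond_bracket_linear | assumption)+
qed


section \<open>The operators on polynomials\<close>

lemma vector_space_smult: "vector_space (smult :: complex \<Rightarrow> complex poly \<Rightarrow> complex poly)"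
  by unfold_locales (simp_all add: smult_add_left smult_add_right)

interpretation smult: vector_space "smult :: complex \<Rightarrow> complex poly \<Rightarrow> complex poly"
  by (rule vector_space_smult)

lemma subspace_V_gr: "smult.subspace (V_gr i)"
proof -
  have "smult.subspace (range (\<lambda>f. f \<circ>\<^sub>p X\<^sup>2))"
    unfolding smult.subspace_def
    by (auto intro: range_eqI[of _ _ 0] simp flip: pcompose_add pcompose_smult)
  \<comment> \<open>\<open>mult_pCons_left\<close> is switched off, here and below, because it would
    expand \<open>X * p\<close> and hide the factor \<open>X\<close>.\<close>
  moreover have "smult.subspace (range (\<lambda>f. X * (f \<circ>\<^sub>p X\<^sup>2)))"
    unfolding smult.subspace_def
    by (auto intro: range_eqI[of _ _ 0]
        simp flip: distrib_left pcompose_add mult_smult_right pcompose_smult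
        simp del: mult_pCons_left)
  ultimately show ?thesis by (simp add: V_gr_def)
qed

lemma super_vector_space_V: "super_vector_space smult V_gr"
proof unfold_locales
  show "smult.subspace (V_gr i)" for i by (rule subspace_V_gr)
  show "V_gr 0 \<inter> V_gr 1 = {0}"
  proof
    show "V_gr 0 \<inter> V_gr 1 \<subseteq> {0}"
    proof
      fix v assume v: "v \<in> V_gr 0 \<inter> V_gr 1"
      then have "v \<in> range (\<lambda>f. f \<circ>\<^sub>p X\<^sup>2)" "v \<in> range (\<lambda>f. X * (f \<circ>\<^sub>p X\<^sup>2))"
        by (simp_all add: V_gr_def del: mult_pCons_left)
      then obtain f g where "v = f \<circ>\<^sub>p X\<^sup>2" "v = X * (g \<circ>\<^sub>p X\<^sup>2)"
        by blast
      \<comment> \<open>The form f(x^2) kills the odd coefficients of \<open>v\<close>, the form x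
        g(x^2) the even ones.\<close>
      then have "odd_coeffs v = 0" "even_coeffs v = 0"
        by (metis even_odd_coeffs)+
      then show "v \<in> {0}" using even_odd_decomposition[of v] by simp
    qed
  qed (use smult.subspace_0[OF subspace_V_gr] in auto)
  show "\<exists>a\<in>V_gr 0. \<exists>b\<in>V_gr 1. v = a + b" for v
    using even_odd_decomposition[of v] by (auto simp: V_gr_def simp del: mult_pCons_left)
qed

section \<open>The basis operators in the variable t = x^2\<close>

lemma even_coeffs_add: "even_coeffs (v + w) = even_coeffs v + even_coeffs w"
  and odd_coeffs_add: "odd_coeffs (v + w) = odd_coeffs v + odd_coeffs w"
  and even_coeffs_smult: "even_coeffs (smult c v) = smult c (even_coeffs v)"
  and odd_coeffs_smult: "odd_coeffs (smult c v) = smult c (odd_coeffs v)"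
  by (simp_all add: poly_eq_iff coeff_even_coeffs coeff_odd_coeffs)

lemma basis_act_add: "basis_act lam al b (v + w) = basis_act lam al b v + basis_act lam al b w"
  by (cases b) (simp_all add: L_op_def G_op_def on_parts_def even_coeffs_add odd_coeffs_add
      pcompose_add distrib_left smult_add_right add_ac del: mult_pCons_left)

lemma basis_act_smult: "basis_act lam al b (smult c v) = smult c (basis_act lam al b v)"
  by (cases b) (simp_all add: L_op_def G_op_def on_parts_def even_coeffs_smult odd_coeffs_smult
      pcompose_smult smult_add_right mult.commute[of c] del: mult_pCons_left)

lemma sq_plus_eq_pcompose: "sq_plus c = [:c, 1:] \<circ>\<^sub>p X\<^sup>2"
  by (simp add: pcompose_pCons sq_plus_def add.commute)

text \<open>Each result is again written as h(x^2) or x h(x^2), with the shift moved to t. The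
  formulas can therefore be iterated to compute products of two operators, and the parity of the
  result is visible.\<close>

lemma basis_act_parts:
  "basis_act lam al (L m) (f \<circ>\<^sub>p X\<^sup>2) =
     smult (lam powi m) ([:of_int m * al, 1:] * (f \<circ>\<^sub>p [:of_int m, 1:])) \<circ>\<^sub>p X\<^sup>2"
  "basis_act lam al (L m) (X * (f \<circ>\<^sub>p X\<^sup>2)) =
     X * (smult (lam powi m) ([:of_int m * al + of_int m / 2, 1:] * (f \<circ>\<^sub>p [:of_int m, 1:])) \<circ>\<^sub>p X\<^sup>2)"
  "basis_act lam al (G m) (f \<circ>\<^sub>p X\<^sup>2) =
     X * (smult (lam powi m) (f \<circ>\<^sub>p [:of_int m, 1:]) \<circ>\<^sub>p X\<^sup>2)"
  "basis_act lam al (G m) (X * (f \<circ>\<^sub>p X\<^sup>2)) =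
     smult (lam powi m) ([:2 * of_int m * al, 1:] * (f \<circ>\<^sub>p [:of_int m, 1:])) \<circ>\<^sub>p X\<^sup>2"
  by (simp_all only: basis_act.simps L_op_def G_op_def on_parts_def even_odd_coeffs
      pcompose_0 mult_zero_right smult_0_right add_0_left add_0_right
      sq_plus_eq_pcompose pcompose_assoc pcompose_mult pcompose_smult mult_smult_right mult.assoc)

lemma basis_act_gr:
  assumes "v \<in> V_gr j"
  shows "basis_act lam al b v \<in> V_gr (parity b + j)"
  using assms
  by (cases b; cases j) (auto simp: V_gr_def basis_act_parts simp del: mult_pCons_left basis_act.simps)

section \<open>The action of the whole algebra\<close>

lemma ramond_act_add_left: "ramond_act lam al (a + b) v = ramond_act lam al a v + ramond_act lam al b v"
  by (simp add: ramond_act_def lin_ext_add vector_space_smult)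

lemma ramond_act_scale_left: "ramond_act lam al (rscale c a) v = smult c (ramond_act lam al a v)"
  by (simp add: ramond_act_def lin_ext_rscale vector_space_smult)

lemma ramond_act_add_right: "ramond_act lam al a (v + w) = ramond_act lam al a v + ramond_act lam al a w"
  by (simp add: ramond_act_def basis_act_add lin_ext_add_fun vector_space_smult)

lemma ramond_act_scale_right: "ramond_act lam al a (smult c v) = smult c (ramond_act lam al a v)"
  by (simp add: ramond_act_def basis_act_smult lin_ext_scale_fun[OF vector_space_smult])

lemma ramond_act_zero: "ramond_act lam al 0 v = 0" "ramond_act lam al a 0 = 0"
  using ramond_act_scale_left[of lam al 0 0 v] ramond_act_scale_right[of lam al a 0 0] by simp_all

lemmas ramond_act_linear =
  ramond_act_add_left ramond_act_add_right ramond_act_scale_left ramond_act_scale_right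
  ramond_act_zero

lemma ramond_act_single: "ramond_act lam al (Poly_Mapping.single b c) v = smult c (basis_act lam al b v)"
  by (simp add: ramond_act_def lin_ext_single vector_space_smult)

lemma ramond_act_gr:
  assumes "a \<in> ramond_gr i" "v \<in> V_gr j"
  shows "ramond_act lam al a v \<in> V_gr (i + j)"
  using assms(1)
proof (induction a rule: ramond_gr_induct)
  case (single b c)
  then show ?case
    using basis_act_gr[OF assms(2), of lam al b]
    by (simp add: ramond_act_single smult.subspace_scale[OF subspace_V_gr])
qed (simp_all add: ramond_act_linear smult.subspace_0 smult.subspace_add subspace_V_gr)

text \<open>Both products of operators with indices m and n carry the shift by m + n and the power
  \<open>lam powi (m + n)\<close>; splitting this power uses \<open>lam \<noteq> 0\<close>. What
  remains is an identity between the polynomial factors.\<close>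

lemma basis_act_bracket:
  assumes "lam \<noteq> 0"
  shows "ramond_act lam al (basis_bracket i j) v =
    basis_act lam al i (basis_act lam al j v) -
    smult (koszul (parity i) (parity j)) (basis_act lam al j (basis_act lam al i v))"
    (is "?lhs v = ?rhs v")
proof -
  \<comment> \<open>\<open>poly_ext\<close> passes to values at points, turning composition into
    evaluation. For two odd elements the factors x^2 + 2r al and x^2 + 2s al add up to 2(x^2 + (r+s)
    al), the factor of 2 L_(r+s).\<close>
  have even: "?lhs (f \<circ>\<^sub>p X\<^sup>2) = ?rhs (f \<circ>\<^sub>p X\<^sup>2)" for f
    by (rule poly_ext, cases i; cases j)
      (simp_all add: ramond_act_single basis_act_parts basis_act_smult koszul_def poly_pcompose
        power_int_add assms del: mult_pCons_left basis_act.simps, simp_all add: field_simps)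
  \<comment> \<open>Here two odd elements give x times x^2 + r + 2s al and x times x^2 + s + 2r al.
    Their sum accounts for the extra m/2 in the action of L_m on the odd part.\<close>
  have odd: "?lhs (X * (f \<circ>\<^sub>p X\<^sup>2)) = ?rhs (X * (f \<circ>\<^sub>p X\<^sup>2))" for f
    by (rule poly_ext, cases i; cases j)
      (simp_all add: ramond_act_single basis_act_parts basis_act_smult koszul_def poly_pcompose
        power_int_add assms del: mult_pCons_left basis_act.simps, simp_all add: field_simps)
  have "?lhs (v + w) = ?lhs v + ?lhs w" "?rhs (v + w) = ?rhs v + ?rhs w" for v w
    by (simp_all add: ramond_act_linear basis_act_add smult_add_right)
  then show ?thesis
    using even odd even_odd_decomposition[of v] by metis
qed

text \<open>Linearity in \<open>a\<close> and \<open>b\<close> reduces this to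
  \<open>basis_act_bracket\<close>; since that holds for every vector, \<open>v\<close> stays fixed
  throughout.\<close>

lemma ramond_act_bracket:
  assumes "lam \<noteq> 0" "a \<in> ramond_gr i" "b \<in> ramond_gr j"
  shows "ramond_act lam al (ramond_bracket a b) v =
    ramond_act lam al a (ramond_act lam al b v) -
    smult (koszul i j) (ramond_act lam al b (ramond_act lam al a v))"
  using assms(2)
proof (induction a rule: ramond_gr_induct)
  case (single s c)
  let ?s = "Poly_Mapping.single s 1"
  from assms(3) have "ramond_act lam al (ramond_bracket ?s b) v =
    ramond_act lam al ?s (ramond_act lam al b v) -
    smult (koszul i j) (ramond_act lam al b (ramond_act lam al ?s v))"
  proof (induction b rule: ramond_gr_induct)
    case (single t d)
    then show ?case
      using basis_act_bracket[OF assms(1), of al s t v] \<open>parity s = i\<close>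
      by (simp add: ramond_bracket_single ramond_act_single ramond_act_linear basis_act_smult
          smult_diff_right mult.commute)
  qed (simp_all add: ramond_bracket_linear ramond_act_linear smult_add_right)
  then show ?case
    by (simp only: ramond_bracket_linear ramond_act_linear)
       (simp add: smult_diff_right mult.commute)
qed (simp_all add: ramond_bracket_linear ramond_act_linear smult_add_right)

theorem proposition2p4:
  fixes lam al :: complex
  assumes "lam \<noteq> 0"
  shows "lie_supermodule rscale ramond_gr ramond_bracket smult V_gr (ramond_act lam al)"
proof -
  interpret A: lie_superalgebra rscale ramond_gr ramond_bracket by (rule lie_superalgebra_ramond)
  interpret V: super_vector_space smult V_gr by (rule super_vector_space_V)
  show ?thesis
    by unfold_locales
      (rule vector_space_linearI ramond_act_gr ramond_act_bracket vector_space_rscale vector_space_smult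
        ramond_act_linear assms | assumption)+
qed

end
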